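(* Let $\mathcal{X}\subset\mathbb{R}^q$ be a compact design space and let $f:\mathcal{X}\to\mathbb{R}^p$ be a measurable regression function. Assume that there is a $D$-optimal design on $\mathcal{X}$ which is a continuous design, with probability density $w^{opt}$ with respect to Lebesgue measure on $\mathcal{X}$. Let $g$ be a probability density on $\mathcal{X}$ such that, for some constant $\epsilon>0$, $g(x)>\epsilon$ for all $x\in\mathcal{X}$, and let $x_1,x_2,\dots$ be independent random points of $\mathcal{X}$ generated according to $g$. For each $N$, let $(w^*(x_1),\dots,w^*(x_N))$ be a $D$-optimal weight vector on the sample points $x_1,\dots,x_N$. If $\int_{\mathcal{X}}f^{T}(x)f(x)\,dx$ is bounded (i.e. finite), then $$\det\sum_{i=1}^{N}w^*(x_i)f(x_i)f^{T}(x_i)-\det\int_{\mathcal{X}}w^{opt}(x)f(x)f^{T}(x)\,dx\longrightarrow 0$$ in probability as $N\to\infty$.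
   Context: A design on $\mathcal{X}$ is a probability measure on $\mathcal{X}$; it is called approximate if it is a discrete probability measure and continuous if it has a density with respect to Lebesgue measure on $\mathcal{X}$. The information matrix of an approximate design with weights $w_j$ at points $x_j$ is $\sum_j w_j f(x_j)f^T(x_j)$, and that of a continuous design with density $w$ is $\int_{\mathcal{X}}w(x)f(x)f^T(x)\,dx$. That $w^{opt}$ is $D$-optimal on $\mathcal{X}$ means that its information matrix is well defined (finite) and that its determinant is at least the determinant of the (finite) information matrix of every approximate or continuous design on $\mathcal{X}$. A $D$-optimal weight vector on points $x_1,\dots,x_N$ is a maximizer of $\det\sum_{i=1}^N w_i f(x_i)f^T(x_i)$ over all $(w_1,\dots,w_N)$ with $w_i\ge 0$ and $\sum_{i=1}^N w_i=1$. *)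

theory Defs
  imports "HOL-Probability.Probability"
begin

abbreviation lborel_on :: "'a::euclidean_space set \<Rightarrow> 'a measure" where
  "lborel_on X \<equiv> restrict_space lborel X"

text \<open>The rank-one matrix \<open>v v\<^sup>T\<close>. The type of \<^const>\<open>columnvector\<close> leaves the inner index type
  open, so the annotations are needed to make it a one-element type.\<close>

definition outer :: "real^'p \<Rightarrow> real^'p^'p" where
  "outer v = (columnvector v :: real^1^'p) ** (rowvector v :: real^'p^1)"

lemma outer_nth: "outer v $ i $ j = v $ i * v $ j"
  by (simp add: outer_def matrix_matrix_mult_def columnvector_def rowvector_def)

definition prob_density_on :: "'a::euclidean_space set \<Rightarrow> ('a \<Rightarrow> real) \<Rightarrow> bool" where
  "prob_density_on X w \<longleftrightarrow>
     (\<forall>x\<in>X. 0 \<le> w x) \<and> integrable (lborel_on X) w \<and> (\<integral>x. w x \<partial>lborel_on X) = 1"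

text \<open>A continuous design on \<open>X\<close> is given by its Lebesgue density \<open>w\<close>. Its information matrix is
  meaningful only if the matrix-valued integrand is integrable, which for \<open>w \<ge> 0\<close> means that all
  entries have finite absolute integrals.\<close>

definition cont_info_finite ::
  "'a::euclidean_space set \<Rightarrow> ('a \<Rightarrow> real^'p) \<Rightarrow> ('a \<Rightarrow> real) \<Rightarrow> bool" where
  "cont_info_finite X f w \<longleftrightarrow> integrable (lborel_on X) (\<lambda>x. w x *\<^sub>R outer (f x))"

definition cont_info ::
  "'a::euclidean_space set \<Rightarrow> ('a \<Rightarrow> real^'p) \<Rightarrow> ('a \<Rightarrow> real) \<Rightarrow> real^'p^'p" where
  "cont_info X f w = (\<integral>x. w x *\<^sub>R outer (f x) \<partial>lborel_on X)"

text \<open>An approximate design is a discrete probability measure, that is a \<^typ>\<open>'a pmf\<close>. Its support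
  may be countably infinite, so the weighted sum over its support points need not be finite.\<close>

definition approx_info_finite :: "('a \<Rightarrow> real^'p) \<Rightarrow> 'a pmf \<Rightarrow> bool" where
  "approx_info_finite f d \<longleftrightarrow> (\<lambda>x. pmf d x *\<^sub>R outer (f x)) summable_on set_pmf d"

definition approx_info :: "('a \<Rightarrow> real^'p) \<Rightarrow> 'a pmf \<Rightarrow> real^'p^'p" where
  "approx_info f d = (\<Sum>\<^sub>\<infinity>x\<in>set_pmf d. pmf d x *\<^sub>R outer (f x))"

definition D_optimal_continuous ::
  "'a::euclidean_space set \<Rightarrow> ('a \<Rightarrow> real^'p) \<Rightarrow> ('a \<Rightarrow> real) \<Rightarrow> bool" where
  "D_optimal_continuous X f w \<longleftrightarrow>
     prob_density_on X w \<and> cont_info_finite X f w \<and>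
     (\<forall>d. set_pmf d \<subseteq> X \<longrightarrow> approx_info_finite f d \<longrightarrow>
        det (approx_info f d) \<le> det (cont_info X f w)) \<and>
     (\<forall>v. prob_density_on X v \<longrightarrow> cont_info_finite X f v \<longrightarrow>
        det (cont_info X f v) \<le> det (cont_info X f w))"

text \<open>Samples are indexed from \<open>0\<close>: the first \<open>N\<close> points are \<open>x 0, \<dots>, x (N - 1)\<close>.\<close>

definition sample_info ::
  "('a \<Rightarrow> real^'p) \<Rightarrow> nat \<Rightarrow> (nat \<Rightarrow> 'a) \<Rightarrow> (nat \<Rightarrow> real) \<Rightarrow> real^'p^'p" where
  "sample_info f N x w = (\<Sum>i<N. w i *\<^sub>R outer (f (x i)))"

definition weight_vector :: "nat \<Rightarrow> (nat \<Rightarrow> real) \<Rightarrow> bool" where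
  "weight_vector N w \<longleftrightarrow> (\<forall>i<N. 0 \<le> w i) \<and> (\<Sum>i<N. w i) = 1"

definition D_optimal_weights ::
  "('a \<Rightarrow> real^'p) \<Rightarrow> nat \<Rightarrow> (nat \<Rightarrow> 'a) \<Rightarrow> (nat \<Rightarrow> real) \<Rightarrow> bool" where
  "D_optimal_weights f N x w \<longleftrightarrow>
     weight_vector N w \<and>
     (\<forall>v. weight_vector N v \<longrightarrow> det (sample_info f N x v) \<le> det (sample_info f N x w))"

text \<open>Measurability is part of the notion, because \<^const>\<open>measure\<close> is \<open>0\<close> on non-measurable
  sets.\<close>

definition tendsto_zero_in_prob :: "'w measure \<Rightarrow> (nat \<Rightarrow> 'w \<Rightarrow> real) \<Rightarrow> bool" where
  "tendsto_zero_in_prob M Y \<longleftrightarrow>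
     (\<forall>n. Y n \<in> borel_measurable M) \<and>
     (\<forall>e>0. (\<lambda>n. measure M {\<omega> \<in> space M. \<bar>Y n \<omega>\<bar> > e}) \<longlonglongrightarrow> 0)"

end

theory Submission
  imports Defs
begin

text \<open>Weights on a sample from \<open>X\<close> form an approximate design on \<open>X\<close>, so the sample optimum never
  exceeds the optimum over \<open>X\<close>. For the converse let \<open>v\<close> be \<open>wopt\<close> cut off to \<open>0\<close> where \<open>wopt\<close> or \<open>f\<close>
  is large; by dominated convergence the normalised information matrix of \<open>v\<close> is nearly that of
  \<open>wopt\<close>. The weights proportional to \<open>v (x\<^sub>i) / g (x\<^sub>i)\<close> (importance sampling) are bounded because
  \<open>g > \<epsilon>\<close>, and by the weak law of large numbers, which Hoeffding's inequality gives for bounded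
  variables, their information matrix converges in probability to the normalised one of \<open>v\<close>.\<close>

section \<open>Continuity and measurability of determinants, outer products and maxima\<close>

lemma tendsto_det:
  fixes A :: "real^'n^'n"
  assumes "(F \<longlongrightarrow> A) G"
  shows "((\<lambda>x. det (F x)) \<longlongrightarrow> det A) G"
  unfolding det_def using assms by (intro tendsto_intros)

lemma continuous_on_det [continuous_intros]:
  fixes F :: "'b::topological_space \<Rightarrow> real^'n^'n"
  assumes "continuous_on S F"
  shows "continuous_on S (\<lambda>x. det (F x))"
  using assms by (auto simp: continuous_on_def intro: tendsto_det)

lemma borel_measurable_det [measurable]:
  "(det :: real^'n^'n \<Rightarrow> real) \<in> borel_measurable borel"
  by (intro borel_measurable_continuous_onI continuous_intros)

lemma borel_measurable_outer [measurable]: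
  "(outer :: real^'n \<Rightarrow> real^'n^'n) \<in> borel_measurable borel"
proof -
  have "outer = (\<lambda>v::real^'n. \<chi> i j. v $ i * v $ j)"
    by (simp add: fun_eq_iff vec_eq_iff outer_nth)
  moreover have "continuous_on UNIV (\<lambda>v::real^'n. (\<chi> i j. v $ i * v $ j) :: real^'n^'n)"
    by (intro continuous_intros)
  ultimately show ?thesis
    by (simp only: borel_measurable_continuous_onI)
qed

text \<open>The maximizer \<open>m\<close> itself need not be measurable.\<close>

lemma borel_measurable_maximum:
  fixes \<phi> :: "'v::{metric_space, second_countable_topology} \<Rightarrow> 'w \<Rightarrow> real"
  assumes cont: "\<And>\<omega>. \<omega> \<in> space M \<Longrightarrow> continuous_on UNIV (\<lambda>v. \<phi> v \<omega>)"
    and meas: "\<And>v. v \<in> W \<Longrightarrow> \<phi> v \<in> borel_measurable M"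
    and mem: "\<And>\<omega>. \<omega> \<in> space M \<Longrightarrow> m \<omega> \<in> W"
    and max: "\<And>\<omega> v. \<omega> \<in> space M \<Longrightarrow> v \<in> W \<Longrightarrow> \<phi> v \<omega> \<le> \<phi> (m \<omega>) \<omega>"
  shows "(\<lambda>\<omega>. \<phi> (m \<omega>) \<omega>) \<in> borel_measurable M"
proof -
  obtain T where T: "countable T" "T \<subseteq> W" "W \<subseteq> closure T"
    using separable by blast
  show ?thesis
    unfolding borel_measurable_iff_greater
  proof
    fix c
    \<comment> \<open>By continuity \<open>{v. c < \<phi> v \<omega>}\<close> is open, so once it
      contains the maximizer, which lies in the closure of \<open>T\<close>, it meets
      \<open>T\<close>. The event thus becomes a countable union in which \<open>m\<close> no longer
      occurs.\<close>
    have "{\<omega> \<in> space M. c < \<phi> (m \<omega>) \<omega>} = (\<Union>v\<in>T. {\<omega> \<in> space M. c < \<phi> v \<omega>})"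
    proof (intro set_eqI iffI)
      fix \<omega> assume "\<omega> \<in> {\<omega> \<in> space M. c < \<phi> (m \<omega>) \<omega>}"
      then have \<omega>: "\<omega> \<in> space M" and c: "c < \<phi> (m \<omega>) \<omega>" by auto
      have "open {v. c < \<phi> v \<omega>}"
        by (intro open_Collect_less continuous_intros cont \<omega>)
      moreover have "m \<omega> \<in> closure T"
        using mem[OF \<omega>] T by auto
      ultimately have "{v. c < \<phi> v \<omega>} \<inter> T \<noteq> {}"
        using c by (subst (asm) closure_iff_nhds_not_empty) blast
      then show "\<omega> \<in> (\<Union>v\<in>T. {\<omega> \<in> space M. c < \<phi> v \<omega>})"
        using \<omega> by auto
    next
      fix \<omega> assume "\<omega> \<in> (\<Union>v\<in>T. {\<omega> \<in> space M. c < \<phi> v \<omega>})"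
      then obtain v where "v \<in> T" "\<omega> \<in> space M" "c < \<phi> v \<omega>" by auto
      then show "\<omega> \<in> {\<omega> \<in> space M. c < \<phi> (m \<omega>) \<omega>}"
        using max[of \<omega> v] T by force
    qed
    also have "\<dots> \<in> sets M"
    proof (intro sets.countable_UN'' T(1))
      fix v assume "v \<in> T"
      then have [measurable]: "\<phi> v \<in> borel_measurable M" using meas T by auto
      show "{\<omega> \<in> space M. c < \<phi> v \<omega>} \<in> sets M" by measurable
    qed
    finally show "{\<omega> \<in> space M. c < \<phi> (m \<omega>) \<omega>} \<in> sets M" .
  qed
qed

section \<open>Weak law of large numbers for bounded variables\<close>

lemma (in prob_space) weak_law_bounded_real:
  fixes Y :: "nat \<Rightarrow> 'a \<Rightarrow> real"
  assumes indep: "indep_vars (\<lambda>_. borel) Y UNIV"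
    and bound: "\<And>i \<omega>. \<omega> \<in> space M \<Longrightarrow> \<bar>Y i \<omega>\<bar> \<le> B"
    and mean: "\<And>i. expectation (Y i) = \<mu>"
    and \<delta>: "\<delta> > 0"
  shows "(\<lambda>n. prob {\<omega> \<in> space M. \<delta> \<le> \<bar>(\<Sum>i<n. Y i \<omega>) / real n - \<mu>\<bar>}) \<longlonglongrightarrow> 0"
proof -
  \<comment> \<open>\<open>B\<close> may be 0; a strictly positive bound keeps the denominators in
    \<open>r\<close> and in Hoeffding's exponent nonzero.\<close>
  define C where "C = \<bar>B\<bar> + 1"
  have C: "C > 0" by (simp add: C_def)
  have YC: "\<bar>Y i \<omega>\<bar> \<le> C" if "\<omega> \<in> space M" for i \<omega>
    using bound[OF that, of i] by (simp add: C_def)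
  \<comment> \<open>Hoeffding's exponent per observation: with n intervals of length 2C and
    deviation n\<delta> it is 2(n\<delta>)^2 / (n(2C)^2) = n\<delta>^2 / (2C^2). Hence the tail
    decays geometrically in n.\<close>
  define r where "r = \<delta>\<^sup>2 / (2 * C\<^sup>2)"
  have r: "r > 0" using \<delta> C by (simp add: r_def)
  have le: "prob {\<omega> \<in> space M. \<delta> \<le> \<bar>(\<Sum>i<n. Y i \<omega>) / real n - \<mu>\<bar>} \<le> 2 * exp (- r) ^ n"
    if n: "n > 0" for n
  proof -
    interpret H: Hoeffding_ineq M "{..<n}" Y "\<lambda>_. - C" "\<lambda>_. C" "n * \<mu>"
    proof unfold_locales
      show "indep_vars (\<lambda>_. borel) Y {..<n}"
        by (rule indep_vars_subset[OF indep]) auto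
      show "AE \<omega> in M. Y i \<omega> \<in> {- C..C}" if "i \<in> {..<n}" for i
        using YC[of _ i] by (intro AE_I2) (simp add: abs_le_iff minus_le_iff)
    qed (simp_all add: mean)
    have "{\<omega> \<in> space M. \<delta> \<le> \<bar>(\<Sum>i<n. Y i \<omega>) / real n - \<mu>\<bar>} =
          {\<omega> \<in> space M. \<bar>(\<Sum>i<n. Y i \<omega>) - n * \<mu>\<bar> \<ge> n * \<delta>}"
    proof -
      have "\<delta> \<le> \<bar>s / real n - \<mu>\<bar> \<longleftrightarrow> \<bar>s - n * \<mu>\<bar> \<ge> n * \<delta>" for s
      proof -
        have "s / n - \<mu> = (s - n * \<mu>) / n" using n by (simp add: field_simps)
        then show ?thesis using n by (simp add: field_simps abs_divide)
      qed
      then show ?thesis by simp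
    qed
    also have "prob \<dots> \<le> 2 * exp (-2 * (n * \<delta>)\<^sup>2 / (\<Sum>i<n. (C - - C)\<^sup>2))"
      using n \<delta> C by (intro H.Hoeffding_ineq_abs_ge) auto
    also have "-2 * (n * \<delta>)\<^sup>2 / (\<Sum>i<n. (C - - C)\<^sup>2) = real n * (- r)"
      using n C by (simp add: r_def power2_eq_square field_simps)
    also have "exp (real n * (- r)) = exp (- r) ^ n"
      by (rule exp_of_nat_mult)
    finally show ?thesis .
  qed
  have "(\<lambda>n. 2 * exp (- r) ^ n) \<longlonglongrightarrow> 2 * 0"
    using r by (intro tendsto_intros LIMSEQ_power_zero) auto
  then have "(\<lambda>n. 2 * exp (- r) ^ n) \<longlonglongrightarrow> 0" by simp
  moreover have "\<forall>\<^sub>F n in sequentially.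
      norm (prob {\<omega> \<in> space M. \<delta> \<le> \<bar>(\<Sum>i<n. Y i \<omega>) / real n - \<mu>\<bar>}) \<le> 2 * exp (- r) ^ n"
    using eventually_gt_at_top[of 0] by eventually_elim (use le in simp)
  ultimately show ?thesis by (rule Lim_null_comparison[rotated])
qed

text \<open>The norm is at most the sum of the absolute coordinates, so a deviation of \<delta>
  forces some coordinate to deviate by at least \<open>\<delta> / DIM('b)\<close>. The real case
  applies to each coordinate, and a union bound over the finite basis finishes.\<close>

lemma (in prob_space) weak_law_bounded:
  fixes Y :: "nat \<Rightarrow> 'a \<Rightarrow> 'b::euclidean_space"
  assumes indep: "indep_vars (\<lambda>_. borel) Y UNIV"
    and bound: "\<And>i \<omega>. \<omega> \<in> space M \<Longrightarrow> norm (Y i \<omega>) \<le> B"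
    and mean: "\<And>i. expectation (Y i) = \<mu>"
    and \<delta>: "\<delta> > 0"
  shows "(\<lambda>n. prob {\<omega> \<in> space M. \<delta> \<le> norm ((\<Sum>i<n. Y i \<omega>) /\<^sub>R real n - \<mu>)}) \<longlonglongrightarrow> 0"
proof -
  have rv [measurable]: "Y i \<in> borel_measurable M" for i
    using indep by (auto simp: indep_vars_def2)
  have int: "integrable M (Y i)" for i
    using bound by (intro integrable_const_bound[where B = B]) auto
  define \<eta> where "\<eta> = \<delta> / DIM('b)"
  have \<eta>: "\<eta> > 0" using \<delta> by (simp add: \<eta>_def)
  define E where "E b n = {\<omega> \<in> space M. \<eta> \<le> \<bar>(\<Sum>i<n. Y i \<omega> \<bullet> b) / real n - \<mu> \<bullet> b\<bar>}" for b n
  have E [measurable]: "E b n \<in> events" for b n unfolding E_def by measurable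
  have lim: "(\<lambda>n. prob (E b n)) \<longlonglongrightarrow> 0" if b: "b \<in> Basis" for b
    unfolding E_def
  proof (rule weak_law_bounded_real[where B = B])
    show "indep_vars (\<lambda>_. borel) (\<lambda>i \<omega>. Y i \<omega> \<bullet> b) UNIV"
      by (rule indep_vars_compose2[OF indep]) simp
    show "\<bar>Y i \<omega> \<bullet> b\<bar> \<le> B" if "\<omega> \<in> space M" for i \<omega>
      using Basis_le_norm[OF b, of "Y i \<omega>"] bound[OF that, of i] by linarith
    show "expectation (\<lambda>\<omega>. Y i \<omega> \<bullet> b) = \<mu> \<bullet> b" for i
      using int[of i] mean[of i] by simp
  qed (rule \<eta>)
  have "prob {\<omega> \<in> space M. \<delta> \<le> norm ((\<Sum>i<n. Y i \<omega>) /\<^sub>R real n - \<mu>)} \<le> (\<Sum>b\<in>Basis. prob (E b n))"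
    for n
  proof -
    have "{\<omega> \<in> space M. \<delta> \<le> norm ((\<Sum>i<n. Y i \<omega>) /\<^sub>R real n - \<mu>)} \<subseteq> (\<Union>b\<in>Basis. E b n)"
    proof
      fix \<omega> assume \<omega>: "\<omega> \<in> {\<omega> \<in> space M. \<delta> \<le> norm ((\<Sum>i<n. Y i \<omega>) /\<^sub>R real n - \<mu>)}"
      let ?z = "(\<Sum>i<n. Y i \<omega>) /\<^sub>R real n - \<mu>"
      show "\<omega> \<in> (\<Union>b\<in>Basis. E b n)"
      proof (rule ccontr)
        assume "\<omega> \<notin> (\<Union>b\<in>Basis. E b n)"
        then have "\<bar>?z \<bullet> b\<bar> < \<eta>" if "b \<in> Basis" for b
          using \<omega> that by (auto simp: E_def inner_diff_left inner_sum_left divide_inverse_commute not_le)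
        then have "(\<Sum>b\<in>Basis. \<bar>?z \<bullet> b\<bar>) < (\<Sum>b\<in>(Basis :: 'b set). \<eta>)"
          by (intro sum_strict_mono) auto
        also have "\<dots> = \<delta>" by (simp add: \<eta>_def)
        finally show False using norm_le_l1[of ?z] \<omega> by simp
      qed
    qed
    then have "prob {\<omega> \<in> space M. \<delta> \<le> norm ((\<Sum>i<n. Y i \<omega>) /\<^sub>R real n - \<mu>)} \<le> prob (\<Union>b\<in>Basis. E b n)"
      by (intro finite_measure_mono) auto
    also have "\<dots> \<le> (\<Sum>b\<in>Basis. prob (E b n))"
      by (intro finite_measure_subadditive_finite) auto
    finally show ?thesis .
  qed
  then have "\<forall>\<^sub>F n in sequentially.
      norm (prob {\<omega> \<in> space M. \<delta> \<le> norm ((\<Sum>i<n. Y i \<omega>) /\<^sub>R real n - \<mu>)}) \<le> (\<Sum>b\<in>Basis. prob (E b n))"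
    unfolding real_norm_def abs_of_nonneg[OF measure_nonneg] by (intro always_eventually allI)
  moreover have "(\<lambda>n. \<Sum>b\<in>Basis. prob (E b n)) \<longlonglongrightarrow> 0"
    by (intro tendsto_null_sum lim)
  ultimately show ?thesis by (rule Lim_null_comparison)
qed

section \<open>Sample weights as approximate designs\<close>

lemma sample_info_eq_approx_info:
  assumes w: "weight_vector N w"
  obtains d where "set_pmf d \<subseteq> x ` {..<N}" "finite (set_pmf d)"
    "approx_info f d = sample_info f N x w"
proof -
  \<comment> \<open>\<open>weight_vector\<close> says nothing about indices from \<open>N\<close>
    on, whereas \<open>embed_pmf\<close> needs a mass function on all of \<open>nat\<close>.\<close>
  define u where "u i = (if i < N then w i else 0)" for i
  have u: "u i \<ge> 0" for i using w by (simp add: u_def weight_vector_def)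
  define p where "p = embed_pmf u"
  have "(\<integral>\<^sup>+ i. ennreal (u i) \<partial>count_space UNIV) = (\<Sum>i<N. ennreal (u i))"
    by (rule nn_integral_count_space') (auto simp: u_def)
  also have "\<dots> = ennreal (\<Sum>i<N. u i)"
    using u by (simp add: sum_ennreal)
  also have "(\<Sum>i<N. u i) = 1"
    using w by (simp add: u_def weight_vector_def)
  finally have sum: "(\<integral>\<^sup>+ i. ennreal (u i) \<partial>count_space UNIV) = 1" by simp
  have pmf: "pmf p i = u i" for i
    unfolding p_def by (rule pmf_embed_pmf[OF u sum])
  have supp: "set_pmf p \<subseteq> {..<N}"
    by (auto simp: set_pmf_eq pmf u_def split: if_splits)
  \<comment> \<open>Sample points may coincide. Pushing the distribution on indices forward along
    \<open>x\<close> adds up the weights of equal points, and writing the information matrix as an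
    expectation lets the change of variables do this bookkeeping.\<close>
  define d where "d = map_pmf x p"
  have fin: "finite (set_pmf d)"
    using finite_subset[OF supp] by (simp add: d_def)
  have "approx_info f d = (\<Sum>y\<in>set_pmf d. pmf d y *\<^sub>R outer (f y))"
    using fin by (simp add: approx_info_def)
  also have "\<dots> = (\<integral>y. outer (f y) \<partial>d)"
    using fin by (intro integral_measure_pmf[symmetric])
  also have "\<dots> = (\<integral>i. outer (f (x i)) \<partial>p)"
    by (simp add: d_def)
  also have "\<dots> = (\<Sum>i<N. pmf p i *\<^sub>R outer (f (x i)))"
    using supp by (intro integral_measure_pmf) auto
  also have "\<dots> = sample_info f N x w"
    by (simp add: pmf u_def sample_info_def)
  finally show ?thesis
    using that[of d] fin supp by (auto simp: d_def)
qed

text \<open>The design built from the weights has finite support, so its information matrix is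
  finite and the optimality of \<open>w\<close> among approximate designs applies to it.\<close>

lemma det_sample_info_le:
  assumes opt: "D_optimal_continuous X f w" and v: "weight_vector N v"
    and x: "\<And>i. i < N \<Longrightarrow> x i \<in> X"
  shows "det (sample_info f N x v) \<le> det (cont_info X f w)"
proof -
  obtain d where d: "set_pmf d \<subseteq> x ` {..<N}" "finite (set_pmf d)"
    "approx_info f d = sample_info f N x v"
    using sample_info_eq_approx_info[OF v] .
  then have "set_pmf d \<subseteq> X" "approx_info_finite f d"
    using x by (auto simp: approx_info_finite_def)
  then show ?thesis using opt d(3) by (metis D_optimal_continuous_def)
qed

section \<open>Truncation of densities and one-sided convergence in probability\<close>

lemma integral_truncation_tendsto:
  fixes G :: "'a \<Rightarrow> 'b::euclidean_space" and w :: "'a \<Rightarrow> real"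
  assumes [measurable]: "w \<in> borel_measurable N" "G \<in> borel_measurable N"
    and int: "integrable N (\<lambda>y. w y *\<^sub>R G y)"
  shows "(\<lambda>k. \<integral>y. (if w y \<le> real k \<and> norm (G y) \<le> real k then w y else 0) *\<^sub>R G y \<partial>N)
    \<longlonglongrightarrow> (\<integral>y. w y *\<^sub>R G y \<partial>N)"
proof (rule integral_dominated_convergence[where w = "\<lambda>y. norm (w y *\<^sub>R G y)"])
  \<comment> \<open>At each fixed \<open>y\<close> the cut-off is inactive for all large
    \<open>k\<close>, so the integrands are eventually constant there.\<close>
  show "AE y in N. (\<lambda>k. (if w y \<le> real k \<and> norm (G y) \<le> real k then w y else 0) *\<^sub>R G y)
      \<longlonglongrightarrow> w y *\<^sub>R G y"
  proof (intro AE_I2 tendsto_eventually)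
    fix y
    obtain m where "max (w y) (norm (G y)) \<le> real m" using real_arch_simple by blast
    then show "\<forall>\<^sub>F k in sequentially.
        (if w y \<le> real k \<and> norm (G y) \<le> real k then w y else 0) *\<^sub>R G y = w y *\<^sub>R G y"
      by (intro eventually_mono[OF eventually_ge_at_top[of m]]) auto
  qed
qed (use integrable_norm[OF int] in auto)

text \<open>As \<open>Y n\<close> is never positive for n \<ge> 1, only deviations below
  \<open>- e\<close> count, and these lie in events \<open>A n\<close> of vanishing probability.
  Index 0 is left out because no weight vector on an empty sample exists.\<close>

lemma tendsto_zero_in_probI_le:
  assumes "prob_space M"
    and meas: "\<And>n. Y n \<in> borel_measurable M"
    and le: "\<And>n \<omega>. n \<ge> 1 \<Longrightarrow> \<omega> \<in> space M \<Longrightarrow> Y n \<omega> \<le> 0"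
    and bad: "\<And>e. e > 0 \<Longrightarrow> \<exists>A. (\<forall>n. A n \<in> sets M) \<and> (\<lambda>n. measure M (A n)) \<longlonglongrightarrow> 0 \<and>
      (\<forall>n\<ge>1. \<forall>\<omega>\<in>space M. \<omega> \<notin> A n \<longrightarrow> - e \<le> Y n \<omega>)"
  shows "tendsto_zero_in_prob M Y"
  unfolding tendsto_zero_in_prob_def
proof (intro conjI allI impI)
  interpret prob_space M by fact
  fix e :: real assume "e > 0"
  then obtain A where A: "\<And>n. A n \<in> sets M" "(\<lambda>n. measure M (A n)) \<longlonglongrightarrow> 0"
    "\<And>n \<omega>. n \<ge> 1 \<Longrightarrow> \<omega> \<in> space M \<Longrightarrow> \<omega> \<notin> A n \<Longrightarrow> - e \<le> Y n \<omega>"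
    using bad by metis
  have "measure M {\<omega> \<in> space M. \<bar>Y n \<omega>\<bar> > e} \<le> measure M (A n)" if "n \<ge> 1" for n
  proof (intro finite_measure_mono A(1) subsetI)
    fix \<omega> assume "\<omega> \<in> {\<omega> \<in> space M. \<bar>Y n \<omega>\<bar> > e}"
    then show "\<omega> \<in> A n" using le[OF that, of \<omega>] A(3)[OF that, of \<omega>] by force
  qed
  then have "\<forall>\<^sub>F n in sequentially. norm (measure M {\<omega> \<in> space M. \<bar>Y n \<omega>\<bar> > e}) \<le> measure M (A n)"
    unfolding real_norm_def abs_of_nonneg[OF measure_nonneg]
    by (intro eventually_mono[OF eventually_ge_at_top[of 1]])
  then show "(\<lambda>n. measure M {\<omega> \<in> space M. \<bar>Y n \<omega>\<bar> > e}) \<longlonglongrightarrow> 0"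
    using A(2) by (rule Lim_null_comparison)
qed (rule meas)

theorem theorem3:
  fixes X :: "(real^'q) set"
    and f :: "real^'q \<Rightarrow> real^'p"
    and wopt g :: "real^'q \<Rightarrow> real"
    and \<epsilon> :: real
    and M :: "'w measure"
    and x :: "nat \<Rightarrow> 'w \<Rightarrow> real^'q"
    and wstar :: "nat \<Rightarrow> 'w \<Rightarrow> nat \<Rightarrow> real"
  assumes "compact X"
    and "f \<in> borel_measurable (lborel_on X)"
    and "D_optimal_continuous X f wopt"
    and "prob_density_on X g"
    and "\<epsilon> > 0" and "\<forall>y\<in>X. g y > \<epsilon>"
    and "prob_space M"
    and "prob_space.indep_vars M (\<lambda>_. lborel_on X) x UNIV"
    and "\<forall>i. distributed M (lborel_on X) (x i) (\<lambda>y. ennreal (g y))"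
    and "\<forall>N\<ge>1. \<forall>\<omega>\<in>space M. D_optimal_weights f N (\<lambda>i. x i \<omega>) (wstar N \<omega>)"
    and "integrable (lborel_on X) (\<lambda>y. f y \<bullet> f y)"
  shows "tendsto_zero_in_prob M
    (\<lambda>N \<omega>. det (sample_info f N (\<lambda>i. x i \<omega>) (wstar N \<omega>)) - det (cont_info X f wopt))"
proof -
  interpret prob_space M by fact
  note [measurable] = assms(2)
  let ?B = "lborel_on X"
  have space_B: "space ?B = X" by (simp add: space_restrict_space)
  have w: "\<And>y. y \<in> X \<Longrightarrow> 0 \<le> wopt y" "integrable ?B wopt" "(\<integral>y. wopt y \<partial>?B) = 1"
    and winfo: "integrable ?B (\<lambda>y. wopt y *\<^sub>R outer (f y))"
    using assms(3) by (auto simp: D_optimal_continuous_def prob_density_on_def cont_info_finite_def)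
  have g: "\<And>y. y \<in> X \<Longrightarrow> 0 \<le> g y" "integrable ?B g" "\<And>y. y \<in> X \<Longrightarrow> g y > \<epsilon>"
    using assms(4,6) by (auto simp: prob_density_on_def)
  have [measurable]: "wopt \<in> borel_measurable ?B" "g \<in> borel_measurable ?B"
    using w(2) g(2) by auto
  have x [measurable]: "x i \<in> measurable M ?B" for i
    using assms(9) by (auto simp: distributed_def)
  have xX: "x i \<omega> \<in> X" if "\<omega> \<in> space M" for i \<omega>
    using measurable_space[OF x that] space_B by simp
  have xdist: "distributed M ?B (x i) (\<lambda>y. ennreal (g y))" for i
    using assms(9) by blast
  have opt: "D_optimal_weights f N (\<lambda>i. x i \<omega>) (wstar N \<omega>)" if "N \<ge> 1" "\<omega> \<in> space M" for N \<omega>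
    using assms(10) that by blast
  \<comment> \<open>Pairing the total mass with the information matrix lets one law of large numbers control both
    the normalising constant and the matrix; \<open>\<Psi>\<close> performs the normalisation.\<close>
  define G where "G y = (1 :: real, outer (f y))" for y
  have G [measurable]: "G \<in> borel_measurable ?B" unfolding G_def by measurable
  define \<Psi> :: "real \<times> (real^'p^'p) \<Rightarrow> real" where "\<Psi> z = det (snd z /\<^sub>R fst z)" for z
  \<comment> \<open>The limit point used below, \<open>(1, cont_info X f wopt)\<close>, has nonzero
    mass, and there \<open>\<Psi>\<close> takes the optimal determinant as its value.\<close>
  have \<Psi>: "isCont \<Psi> z" if "fst z \<noteq> 0" for z
    unfolding \<Psi>_def isCont_def using that by (intro tendsto_det tendsto_intros) auto

  \<comment> \<open>Approximation of the optimal density by truncated densities\<close>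
  have wG: "has_bochner_integral ?B (\<lambda>y. wopt y *\<^sub>R G y) (1, cont_info X f wopt)"
  proof -
    have "has_bochner_integral ?B (\<lambda>y. (wopt y, 0) + (0, wopt y *\<^sub>R outer (f y)))
        ((1, 0) + (0, cont_info X f wopt))"
      using has_bochner_integral_integrable[OF w(2)] has_bochner_integral_integrable[OF winfo] w(3)
      by (intro has_bochner_integral_add
          has_bochner_integral_bounded_linear[OF bounded_linear_Pair[OF bounded_linear_ident bounded_linear_zero]]
          has_bochner_integral_bounded_linear[OF bounded_linear_Pair[OF bounded_linear_zero bounded_linear_ident]])
        (auto simp: cont_info_def)
    then show ?thesis by (simp add: G_def)
  qed
  \<comment> \<open>A bound on \<open>norm (G y)\<close> also bounds \<open>outer (f y)\<close>. The
    truncated function is in general not a probability density; its mass is the first component of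
    \<open>z k\<close>.\<close>
  define v where "v k y = (if wopt y \<le> real k \<and> norm (G y) \<le> real k then wopt y else 0)" for k y
  have v [measurable]: "v k \<in> borel_measurable ?B" for k unfolding v_def by measurable
  define z where "z k = (\<integral>y. v k y *\<^sub>R G y \<partial>?B)" for k
  have z: "z \<longlonglongrightarrow> (1, cont_info X f wopt)"
    using integral_truncation_tendsto[of wopt ?B G] wG G
    by (simp add: z_def[abs_def] v_def has_bochner_integral_iff)

  show ?thesis
  proof (rule tendsto_zero_in_probI_le)

    \<comment> \<open>Upper bound by the optimum over the design space\<close>
    fix N \<omega> assume N: "1 \<le> (N::nat)" and \<omega>: "\<omega> \<in> space M"
    show "det (sample_info f N (\<lambda>i. x i \<omega>) (wstar N \<omega>)) - det (cont_info X f wopt) \<le> 0"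
      using det_sample_info_le[OF assms(3), of N "wstar N \<omega>" "\<lambda>i. x i \<omega>"] opt[OF N \<omega>] xX[OF \<omega>]
      by (simp add: D_optimal_weights_def)
  next

    \<comment> \<open>Measurability of the optimal sample determinant\<close>
    fix N
    show "(\<lambda>\<omega>. det (sample_info f N (\<lambda>i. x i \<omega>) (wstar N \<omega>)) - det (cont_info X f wopt))
        \<in> borel_measurable M"
    proof (cases "N = 0")
      \<comment> \<open>Nothing is known about \<open>wstar 0\<close>, but the empty sum makes the
        determinant constant.\<close>
      case True
      then show ?thesis by (simp add: sample_info_def)
    next
      case False
      let ?\<phi> = "\<lambda>v \<omega>. det (sample_info f N (\<lambda>i. x i \<omega>) v)"
      \<comment> \<open>Weights are points of \<open>nat \<Rightarrow> real\<close> with the product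
        topology, a second countable metric space; the determinant is continuous because it involves
        only finitely many coordinates.\<close>
      have "(\<lambda>\<omega>. ?\<phi> (wstar N \<omega>) \<omega>) \<in> borel_measurable M"
      proof (rule borel_measurable_maximum[where \<phi> = ?\<phi> and W = "{v. weight_vector N v}"])
        show "continuous_on UNIV (\<lambda>v. ?\<phi> v \<omega>)" for \<omega>
          unfolding sample_info_def
          by (intro continuous_intros continuous_on_product_coordinates)
        show "?\<phi> v \<in> borel_measurable M" for v
          unfolding sample_info_def by measurable
      qed (use opt False in \<open>auto simp: D_optimal_weights_def\<close>)
      then show ?thesis by measurable
    qed
  next

    \<comment> \<open>Lower bound outside an event of small probability\<close>
    fix e :: real assume e: "e > 0"
    have "(\<lambda>k. \<Psi> (z k)) \<longlonglongrightarrow> det (cont_info X f wopt)"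
      using isCont_tendsto_compose[OF \<Psi> z] by (simp add: \<Psi>_def)
    then have "\<forall>\<^sub>F k in sequentially. \<Psi> (z k) > det (cont_info X f wopt) - e"
      by (rule order_tendstoD) (use e in simp)
    moreover have "\<forall>\<^sub>F k in sequentially. fst (z k) > 0"
      using tendsto_fst[OF z] by (rule order_tendstoD) simp
    ultimately have "\<forall>\<^sub>F k in sequentially. \<Psi> (z k) > det (cont_info X f wopt) - e \<and> fst (z k) > 0"
      by (rule eventually_conj)
    \<comment> \<open>The truncation level is fixed here, depending on \<open>e\<close> alone and
      not on the sample size.\<close>
    then obtain k where k: "\<Psi> (z k) > det (cont_info X f wopt) - e" "fst (z k) > 0"
      by (auto simp: eventually_sequentially)
    have "\<forall>\<^sub>F y in nhds (z k). \<Psi> y > det (cont_info X f wopt) - e"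
      using \<Psi>[of "z k"] k by (intro order_tendstoD(1)) (auto simp: isCont_def tendsto_at_iff_tendsto_nhds)
    moreover have "\<forall>\<^sub>F y in nhds (z k). fst y > 0"
      using k(2) tendsto_fst[OF filterlim_ident[of "nhds (z k)"]] by (rule order_tendstoD(1)[rotated])
    ultimately have "\<forall>\<^sub>F y in nhds (z k). \<Psi> y > det (cont_info X f wopt) - e \<and> fst y > 0"
      by (rule eventually_conj)
    \<comment> \<open>Both strict inequalities persist on a ball around \<open>z k\<close>; its
      radius \<delta> is the deviation to be excluded by the law of large numbers.\<close>
    then obtain \<delta> where \<delta>: "\<delta> > 0"
      "\<And>y. norm (y - z k) < \<delta> \<Longrightarrow> \<Psi> y > det (cont_info X f wopt) - e \<and> fst y > 0"
      by (auto simp: eventually_nhds_metric dist_norm)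
    define h where "h y = v k y / g y" for y
    have h [measurable]: "h \<in> borel_measurable ?B" unfolding h_def by measurable
    have h0: "0 \<le> h y" if "y \<in> X" for y
      using w(1)[OF that] g(1)[OF that] by (simp add: h_def v_def)
    have gh: "g y * h y = v k y" if "y \<in> X" for y
      using g(3)[OF that] assms(5) by (simp add: h_def)
    define Y where "Y i \<omega> = h (x i \<omega>) *\<^sub>R G (x i \<omega>)" for i \<omega>
    have hG [measurable]: "(\<lambda>y. h y *\<^sub>R G y) \<in> borel_measurable ?B" by measurable
    have Y [measurable]: "Y i \<in> borel_measurable M" for i
      unfolding Y_def by measurable
    \<comment> \<open>Where the cut-off is inactive, \<open>h\<close> is at most
      \<open>k / \<epsilon>\<close> because \<open>g\<close> exceeds \<epsilon>, and
      \<open>norm (G y)\<close> is at most \<open>k\<close>; elsewhere \<open>h\<close>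
      vanishes.\<close>
    have bound: "norm (h y *\<^sub>R G y) \<le> k / \<epsilon> * k" if y: "y \<in> X" for y
    proof (cases "wopt y \<le> real k \<and> norm (G y) \<le> real k")
      case True
      have "h y \<le> k / \<epsilon>"
        unfolding h_def v_def using True w(1)[OF y] g(3)[OF y] assms(5) by (auto intro!: frac_le)
      then have "h y * norm (G y) \<le> k / \<epsilon> * k"
        using True h0[OF y] assms(5) by (intro mult_mono) auto
      then show ?thesis using h0[OF y] by simp
    next
      case False
      then have "h y = 0" by (simp only: h_def v_def if_False div_0)
      then show ?thesis using assms(5) by simp
    qed
    \<comment> \<open>Under the sampling density \<open>g\<close> the factor \<open>1 / g\<close> in
      \<open>h\<close> cancels, leaving the integral of \<open>v k y *\<^sub>R G y\<close>.\<close>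
    have mean: "expectation (Y i) = z k" for i
    proof -
      have "expectation (Y i) = (\<integral>y. h y *\<^sub>R G y \<partial>distr M ?B (x i))"
        unfolding Y_def by (rule integral_distr[symmetric]) measurable
      also have "\<dots> = (\<integral>y. h y *\<^sub>R G y \<partial>density ?B (\<lambda>y. ennreal (g y)))"
        by (simp only: distributed_distr_eq_density[OF xdist])
      also have "\<dots> = (\<integral>y. g y *\<^sub>R (h y *\<^sub>R G y) \<partial>?B)"
        using g(1) space_B by (intro integral_density) auto
      also have "\<dots> = z k"
        unfolding z_def using gh space_B by (intro Bochner_Integration.integral_cong) auto
      finally show ?thesis .
    qed
    define A where "A n = {\<omega> \<in> space M. \<delta> \<le> norm ((\<Sum>i<n. Y i \<omega>) /\<^sub>R real n - z k)}" for n
    have "A n \<in> events" for n unfolding A_def by measurable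
    moreover have "(\<lambda>n. prob (A n)) \<longlonglongrightarrow> 0"
      unfolding A_def
    proof (rule weak_law_bounded[OF _ _ mean \<delta>(1)])
      show "indep_vars (\<lambda>_. borel) Y UNIV"
        unfolding Y_def by (rule indep_vars_compose2[OF assms(8)]) measurable
      show "norm (Y i \<omega>) \<le> k / \<epsilon> * k" if "\<omega> \<in> space M" for i \<omega>
        unfolding Y_def by (rule bound[OF xX[OF that]])
    qed
    moreover have "- e \<le> det (sample_info f n (\<lambda>i. x i \<omega>) (wstar n \<omega>)) - det (cont_info X f wopt)"
      if n: "n \<ge> 1" and \<omega>: "\<omega> \<in> space M" "\<omega> \<notin> A n" for n \<omega>
    proof -
      let ?y = "(\<Sum>i<n. Y i \<omega>) /\<^sub>R real n"
      define S where "S = (\<Sum>i<n. h (x i \<omega>))"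
      have y: "\<Psi> ?y > det (cont_info X f wopt) - e" "fst ?y > 0"
        using \<delta>(2)[of ?y] \<omega> by (auto simp: A_def)
      have fst_y: "fst ?y = S / n"
        by (simp add: fst_sum Y_def G_def S_def divide_inverse_commute)
      have snd_y: "snd ?y = (\<Sum>i<n. h (x i \<omega>) *\<^sub>R outer (f (x i \<omega>))) /\<^sub>R n"
        by (simp add: snd_sum Y_def G_def)
      \<comment> \<open>Off \<open>A n\<close> the average stays in the ball, where the mass is
        positive, so the importance weights can be normalised.\<close>
      have S: "S > 0" using y(2) n unfolding fst_y by (simp add: zero_less_divide_iff)
      \<comment> \<open>Dividing by the random total \<open>S\<close> instead of \<open>n\<close>
        gives a true weight vector; the factor 1/n cancels in the quotient taken by
        \<open>\<Psi>\<close>.\<close>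
      define u where "u i = h (x i \<omega>) / S" for i
      have "weight_vector n u"
        using S h0[OF xX[OF \<omega>(1)]]
        by (simp add: weight_vector_def u_def sum_divide_distrib[symmetric] S_def[symmetric])
      then have "det (sample_info f n (\<lambda>i. x i \<omega>) u)
          \<le> det (sample_info f n (\<lambda>i. x i \<omega>) (wstar n \<omega>))"
        using opt[OF n \<omega>(1)] by (simp add: D_optimal_weights_def)
      moreover have "sample_info f n (\<lambda>i. x i \<omega>) u = snd ?y /\<^sub>R fst ?y"
      proof -
        have "sample_info f n (\<lambda>i. x i \<omega>) u = inverse S *\<^sub>R (\<Sum>i<n. h (x i \<omega>) *\<^sub>R outer (f (x i \<omega>)))"
          by (simp add: sample_info_def u_def scaleR_sum_right divide_inverse_commute)
        moreover have "inverse (S / n) * inverse (real n) = inverse S"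
          using n by (simp add: inverse_eq_divide)
        ultimately show ?thesis
          by (simp only: fst_y snd_y scaleR_scaleR)
      qed
      ultimately show ?thesis using y(1) by (simp add: \<Psi>_def)
    qed
    ultimately show "\<exists>A. (\<forall>n. A n \<in> events) \<and> (\<lambda>n. prob (A n)) \<longlonglongrightarrow> 0 \<and>
      (\<forall>n\<ge>1. \<forall>\<omega>\<in>space M. \<omega> \<notin> A n \<longrightarrow>
        - e \<le> det (sample_info f n (\<lambda>i. x i \<omega>) (wstar n \<omega>)) - det (cont_info X f wopt))"
      by (intro exI[of _ A]) auto
  qed (rule assms(7))
qed

end
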